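(* Let $K>0$ and let $f:[0,\infty)\to[0,\infty)$ be continuous with $f(0)=0$, $f(K)=K$ and $f(x)>x$ for all $x\in(0,K)$, and let $f$ be nondecreasing on $(0,\delta)$ for some $\delta\in(0,K)$. Put $F(x)=f(x)-x$ for $x>0$. Let $(\sigma_n)_{n\ge0}$ be a non-increasing sequence of positive numbers with $\sum_n\sigma_n^2<\infty$. Let $(\xi_n)_{n\ge1}$ be independent random variables such that $\xi_n$ has a density $\phi_n$ with $\phi_n(x)>0$ for $x\in(-1,1)$ and $\phi_n(x)=0$ for $x\notin[-1,1]$; assume that either the $\xi_n$ are identically distributed, or there exist $\varepsilon\in(0,1)$ and $p_\varepsilon>0$ such that $\mathbb P\{\xi_n\in[1-\varepsilon,1]\}\ge p_\varepsilon$ for all $n\in\mathbb N$. Suppose also that there exist $M\in(0,\infty)$ and $L\in\mathbb N$ such that for all $n\ge L$ $$\sigma_{n+1}\le F(M\sigma_n).$$ Then any solution of $$x_{n+1}=\max\{f(x_n)+\sigma_n\xi_{n+1},0\},\quad n=0,1,\dots,$$ with an arbitrary initial value $x_0>0$ satisfies $\mathbb P\{\omega:\lim_{n\to\infty}x_n(\omega)=0\}=0$.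
   Context: All random variables are defined on a common complete probability space $(\Omega,\mathcal F,\mathbb P)$. *)

theory Defs
  imports "HOL-Probability.Probability"
begin

end

(* With positive probability, bounded below uniformly in time, a block of J consecutive noises
   exceeds 1 - \<epsilon>, so such blocks recur almost surely. If the path tends to 0, one of them occurs
   where f y \<ge> y, and with J (1 - \<epsilon>) \<ge> M it lifts the path above M \<sigma>_q, where q is the last
   index of the block. The drift condition and the monotonicity of f then show that the constant
   level M \<sigma>_q can never be crossed downwards again, even by the worst noise -1. *)
theory Submission
  imports Defs
begin

text \<open>Cut the indices after \<open>N\<close> into disjoint blocks of length \<open>J\<close>.
  By independence a block lies wholly in \<open>S\<close> with probability at least
  \<open>p ^ J\<close>, and distinct blocks are independent, so the probability that the first
  \<open>r + 1\<close> blocks all fail is at most \<open>(1 - p ^ J) ^ Suc r\<close>, which tends to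
  0.\<close>

lemma (in prob_space) AE_exists_long_run:
  fixes X :: "nat \<Rightarrow> 'a \<Rightarrow> 'b"
  assumes indep: "indep_vars (\<lambda>_. B) X {1..}"
    and S: "S \<in> sets B"
    and p: "0 < p"
    and lower: "\<And>n. n \<ge> 1 \<Longrightarrow> p \<le> prob (X n -` S \<inter> space M)"
    and J: "0 < J"
  shows "AE \<omega> in M. \<exists>n\<ge>N. \<forall>i\<in>{n<..n+J}. X i \<omega> \<in> S"
proof -
  define C where "C k = {N + k * J<..N + k * J + J}" for k
  define G where "G k = (\<Inter>i\<in>C k. X i -` S \<inter> space M)" for k
  \<comment> \<open>\<open>Y k\<close> bundles block \<open>k\<close> into one random element of a
    product space and \<open>A k\<close> encodes failure of the block there, so that independence of
    the blocks follows by grouping independent variables.\<close>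
  define Y where "Y k \<omega> = restrict (\<lambda>i. X i \<omega>) (C k)" for k \<omega>
  define A where "A k = space (PiM (C k) (\<lambda>_. B)) - PiE (C k) (\<lambda>_. S)" for k
  have rv: "X i \<in> measurable M B" if "i \<ge> 1" for i
    using indep that by (auto simp: indep_vars_def)
  have C_ne: "C k \<noteq> {}" and C_fin: "finite (C k)" and C_sub: "C k \<subseteq> {1..}" and C_card: "card (C k) = J" for k
    using J by (auto simp: C_def)
  have G_meas: "G k \<in> sets M" for k
    unfolding G_def using S C_ne C_fin C_sub[of k]
    by (intro sets.finite_INT measurable_sets[OF rv]) auto
  have "disjoint_family_on C UNIV"
  proof -
    have "C j \<inter> C k = {}" if "j < k" for j k
    proof -
      have "Suc j * J \<le> k * J" using that by (intro mult_right_mono) auto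
      then show ?thesis by (auto simp: C_def)
    qed
    then show ?thesis
      unfolding disjoint_family_on_def by (metis Int_commute linorder_neqE_nat)
  qed
  with indep C_sub have indep_Y: "indep_vars (\<lambda>k. PiM (C k) (\<lambda>_. B)) Y UNIV"
    unfolding Y_def by (intro indep_vars_restrict) auto
  have A_meas: "A k \<in> sets (PiM (C k) (\<lambda>_. B))" for k
    unfolding A_def using S C_fin by (intro sets.Diff sets.top sets_PiM_I_finite) auto
  have Y_A: "Y k -` A k \<inter> space M = space M - G k" for k
  proof -
    have "X i \<omega> \<in> space B" if "\<omega> \<in> space M" "i \<in> C k" for \<omega> i
      using rv[of i] that C_sub by (auto dest: measurable_space)
    then show ?thesis
      using C_ne[of k] by (auto simp: Y_def A_def G_def space_PiM PiE_iff)
  qed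
  have G_lower: "p ^ J \<le> prob (G k)" for k
  proof -
    have "p ^ J = (\<Prod>i\<in>C k. p)" by (simp add: C_card)
    also have "\<dots> \<le> (\<Prod>i\<in>C k. prob (X i -` S \<inter> space M))"
      using p lower C_sub by (intro prod_mono) auto
    also have "\<dots> = prob (G k)"
      unfolding G_def using S C_ne C_fin C_sub
      by (intro indep_varsD[OF indep, symmetric]) auto
    finally show ?thesis .
  qed
  define U where "U = (\<Inter>k. space M - G k)"
  have U_meas: "U \<in> sets M"
    unfolding U_def using G_meas by (intro sets.countable_INT) auto
  have U_le: "prob U \<le> (1 - p ^ J) ^ Suc r" for r
  proof -
    have "prob U \<le> prob (\<Inter>k\<in>{..r}. Y k -` A k \<inter> space M)"
      using G_meas by (intro finite_measure_mono) (auto simp: U_def Y_A)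
    also have "\<dots> = (\<Prod>k\<in>{..r}. prob (Y k -` A k \<inter> space M))"
      using A_meas by (intro indep_varsD[OF indep_Y]) auto
    also have "\<dots> \<le> (\<Prod>k\<in>{..r}. 1 - p ^ J)"
      using G_lower G_meas by (intro prod_mono) (auto simp: Y_A prob_compl)
    finally show ?thesis by simp
  qed
  \<comment> \<open>This places \<open>1 - p ^ J\<close> in [0,1), so its powers tend to 0.\<close>
  have "p ^ J \<le> 1"
    using G_lower[of 0] prob_le_1[of "G 0"] by linarith
  then have "(\<lambda>r. (1 - p ^ J) ^ Suc r) \<longlonglongrightarrow> 0"
    using p by (intro LIMSEQ_Suc LIMSEQ_power_zero) auto
  then have "prob U \<le> 0"
    using U_le by (intro LIMSEQ_le_const) auto
  then have "U \<in> null_sets M"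
    using U_meas by (auto simp: emeasure_eq_measure null_sets_def measure_le_0_iff)
  then have "AE \<omega> in M. \<omega> \<notin> U" by (rule AE_not_in)
  then show ?thesis
  proof (rule AE_mp, intro AE_I2 impI)
    fix \<omega> assume "\<omega> \<in> space M" "\<omega> \<notin> U"
    then obtain k where "\<omega> \<in> G k" by (auto simp: U_def)
    then show "\<exists>n\<ge>N. \<forall>i\<in>{n<..n+J}. X i \<omega> \<in> S"
      by (intro exI[of _ "N + k * J"]) (auto simp: G_def C_def)
  qed
qed

text \<open>The deterministic part, to be applied to a single path. The recursion enters only as a
  lower bound, which truncation at 0 respects since it can only raise the value.\<close>

lemma not_tendsto_0_of_long_runs:
  fixes s e \<sigma> :: "nat \<Rightarrow> real" and f :: "real \<Rightarrow> real"
  assumes \<delta>: "0 < \<delta>" and mono: "mono_on {0<..<\<delta>} f"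
    and above: "\<And>y. 0 \<le> y \<Longrightarrow> y < \<delta> \<Longrightarrow> y \<le> f y"
    and \<sigma>: "\<And>n. 0 < \<sigma> n" "decseq \<sigma>"
    and M: "0 < M" and drift: "\<And>n. n \<ge> L \<Longrightarrow> \<sigma> (Suc n) \<le> f (M * \<sigma> n) - M * \<sigma> n"
    and nonneg: "\<And>n. 0 \<le> s n"
    and step: "\<And>n. f (s n) + \<sigma> n * e (Suc n) \<le> s (Suc n)"
    and e: "\<And>n. -1 \<le> e (Suc n)"
    and c: "0 \<le> c" "M \<le> real J * c"
    and runs: "\<And>N. \<exists>n\<ge>N. \<forall>i\<in>{n<..n+J}. c \<le> e i"
  shows "\<not> s \<longlonglongrightarrow> 0"
proof
  assume lim: "s \<longlonglongrightarrow> 0"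
  then have "\<forall>\<^sub>F n in sequentially. s n < \<delta>"
    using \<delta> by (rule order_tendstoD)
  then obtain N where N: "\<And>n. n \<ge> N \<Longrightarrow> s n < \<delta>"
    by (auto simp: eventually_sequentially)
  have "J \<noteq> 0" using M c by (auto intro: Nat.gr0I)
  obtain n where n: "n \<ge> max N L" and run: "\<forall>i\<in>{n<..n+J}. c \<le> e i"
    using runs by blast
  \<comment> \<open>The noises \<open>e (n+1)\<close>, ..., \<open>e (n+J)\<close> carry the
    coefficients \<sigma>_n, ..., \<sigma>_q. The last is the smallest, so each step of the block
    gains at least \<open>c * \<sigma> q\<close>. The next coefficient,
    \<open>\<sigma> (Suc q)\<close>, is the one that the drift condition at \<open>q\<close>
    controls.\<close>
  define q where "q = n + J - 1"
  have q: "Suc q = n + J" "q \<ge> L" "q \<ge> N"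
    using \<open>J \<noteq> 0\<close> n by (auto simp: q_def)
  have climb: "real j * c * \<sigma> q \<le> s (n + j)" if "j \<le> J" for j
    using that
  proof (induction j)
    case 0
    show ?case using nonneg by simp
  next
    case (Suc j)
    have "\<sigma> q \<le> \<sigma> (n + j)"
      using q(1) Suc.prems by (intro decseqD[OF \<sigma>(2)]) linarith
    then have "c * \<sigma> q \<le> c * \<sigma> (n + j)"
      using c(1) by (rule mult_left_mono)
    also have "\<dots> \<le> e (Suc (n + j)) * \<sigma> (n + j)"
      using run Suc.prems \<sigma>(1)[of "n + j"] by (intro mult_right_mono) auto
    finally have "c * \<sigma> q \<le> \<sigma> (n + j) * e (Suc (n + j))"
      by (simp only: mult.commute)
    moreover have "s (n + j) \<le> f (s (n + j))"
      using above nonneg N n by simp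
    ultimately have "s (n + j) + c * \<sigma> q \<le> s (Suc (n + j))"
      using step[of "n + j"] by linarith
    with Suc show ?case by (simp add: algebra_simps)
  qed
  \<comment> \<open>The drift condition at the single index \<open>q\<close> serves every
    \<open>m\<close>: the level is fixed, and a later noise can subtract at most
    \<open>\<sigma> (Suc q + m) \<le> \<sigma> (Suc q)\<close>.\<close>
  have stay: "M * \<sigma> q \<le> s (Suc q + m)" for m
  proof (induction m)
    case 0
    have "M * \<sigma> q \<le> real J * c * \<sigma> q"
      using c \<sigma>(1)[of q] by (intro mult_right_mono) auto
    with climb[of J] show ?case by (simp add: q)
  next
    case (Suc m)
    \<comment> \<open>Since the level is at most \<open>s (Suc q + m)\<close>, these two bounds put
      both points into the interval where \<open>f\<close> is monotone.\<close>
    have "0 < M * \<sigma> q" using M \<sigma>(1) by simp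
    moreover have "s (Suc q + m) < \<delta>" using N q by simp
    ultimately have "f (M * \<sigma> q) \<le> f (s (Suc q + m))"
      using Suc by (intro mono_onD[OF mono]) auto
    moreover have "M * \<sigma> q + \<sigma> (Suc q) \<le> f (M * \<sigma> q)"
      using drift[OF q(2)] by simp
    moreover have "\<sigma> (Suc q + m) \<le> \<sigma> (Suc q)"
      by (intro decseqD[OF \<sigma>(2)]) simp
    moreover have "\<sigma> (Suc q + m) * (-1) \<le> \<sigma> (Suc q + m) * e (Suc (Suc q + m))"
      by (intro mult_left_mono e less_imp_le \<sigma>(1))
    ultimately show ?case
      using step[of "Suc q + m"] by simp
  qed
  have "\<forall>\<^sub>F n in sequentially. s n < M * \<sigma> q"
    using lim M \<sigma>(1) by (intro order_tendstoD) auto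
  then obtain N' where "\<And>n. n \<ge> N' \<Longrightarrow> s n < M * \<sigma> q"
    by (auto simp: eventually_sequentially)
  from this[of "Suc q + N'"] stay[of N'] show False by simp
qed

text \<open>The probability of leaving \<open>A\<close> is the integral of \<open>g\<close> over the
  complement, where \<open>g\<close> vanishes. Applied to the noises, this makes -1 the worst
  case.\<close>

lemma distributed_AE_in:
  assumes "distributed M N X g" and "A \<in> sets N"
    and "\<And>y. y \<in> space N \<Longrightarrow> y \<notin> A \<Longrightarrow> g y = 0"
  shows "AE \<omega> in M. X \<omega> \<in> A"
proof -
  have X: "X \<in> measurable M N"
    using assms(1) by (rule distributed_measurable)
  have "emeasure M (X -` (space N - A) \<inter> space M) = (\<integral>\<^sup>+y. g y * indicator (space N - A) y \<partial>N)"
    using assms by (intro distributed_emeasure) auto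
  also have "\<dots> = (\<integral>\<^sup>+y. 0 \<partial>N)"
    using assms(3) by (intro nn_integral_cong) (auto simp: indicator_def)
  finally have "X -` (space N - A) \<inter> space M \<in> null_sets M"
    using X assms(2) by (auto intro!: measurable_sets)
  from AE_not_in[OF this] AE_space show ?thesis
    by eventually_elim (use X in \<open>auto dest: measurable_space\<close>)
qed

text \<open>If the integral of \<open>g\<close> over \<open>A\<close> were 0, the nonnegative
  integrand would vanish almost everywhere; as \<open>g\<close> is positive on \<open>A\<close>,
  that would make \<open>A\<close> a null set.\<close>

lemma (in prob_space) distributed_prob_pos:
  assumes "distributed M N X g" and "A \<in> sets N" and "emeasure N A \<noteq> 0"
    and "\<And>y. y \<in> A \<Longrightarrow> 0 < g y"
  shows "0 < prob (X -` A \<inter> space M)"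
proof -
  have g[measurable]: "g \<in> borel_measurable N"
    using assms(1) by (rule distributed_borel_measurable)
  have "emeasure M (X -` A \<inter> space M) = (\<integral>\<^sup>+y. g y * indicator A y \<partial>N)"
    using assms by (intro distributed_emeasure)
  moreover have "(\<integral>\<^sup>+y. g y * indicator A y \<partial>N) \<noteq> 0"
  proof
    assume "(\<integral>\<^sup>+y. g y * indicator A y \<partial>N) = 0"
    then have "AE y in N. g y * indicator A y = 0"
      using assms(2) by (subst (asm) nn_integral_0_iff_AE) auto
    then have "AE y in N. y \<notin> A"
      by eventually_elim (use assms(4) in \<open>force simp: indicator_def split: if_splits\<close>)
    with assms(2,3) show False
      by (simp add: AE_iff_measurable[OF assms(2)] sets.sets_into_space AE_iff_null_sets[symmetric] null_setsD1)
  qed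
  ultimately have "emeasure M (X -` A \<inter> space M) \<noteq> 0"
    by simp
  then show ?thesis
    by (auto simp: emeasure_eq_measure zero_less_measure_iff)
qed

theorem lemma5p3:
  fixes P :: "'a measure"
    and K x0 :: real
    and f F :: "real \<Rightarrow> real"
    and \<sigma> :: "nat \<Rightarrow> real"
    and \<xi> :: "nat \<Rightarrow> 'a \<Rightarrow> real"
    and \<phi> :: "nat \<Rightarrow> real \<Rightarrow> real"
    and x :: "nat \<Rightarrow> 'a \<Rightarrow> real"
  assumes "prob_space P" and "complete_measure P"
    and "K > 0"
    and "\<And>y. y \<ge> 0 \<Longrightarrow> f y \<ge> 0"
    and "continuous_on {0..} f"
    and "f 0 = 0" and "f K = K"
    and "\<And>y. 0 < y \<Longrightarrow> y < K \<Longrightarrow> f y > y"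
    and "\<exists>\<delta>. 0 < \<delta> \<and> \<delta> < K \<and> mono_on {0<..<\<delta>} f"
    and "\<And>y. y > 0 \<Longrightarrow> F y = f y - y"
    and "\<And>n. \<sigma> n > 0" and "decseq \<sigma>"
    and "summable (\<lambda>n. (\<sigma> n)\<^sup>2)"
    and "prob_space.indep_vars P (\<lambda>_. borel) \<xi> {1..}"
    and "\<And>n y. n \<ge> 1 \<Longrightarrow> \<phi> n y \<ge> 0"
    and "\<And>n. n \<ge> 1 \<Longrightarrow> distributed P lborel (\<xi> n) (\<lambda>y. ennreal (\<phi> n y))"
    and "\<And>n y. n \<ge> 1 \<Longrightarrow> y \<in> {-1<..<1} \<Longrightarrow> \<phi> n y > 0"
    and "\<And>n y. n \<ge> 1 \<Longrightarrow> y \<notin> {-1..1} \<Longrightarrow> \<phi> n y = 0"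
    and "(\<forall>m\<ge>1. \<forall>n\<ge>1. distr P borel (\<xi> m) = distr P borel (\<xi> n)) \<or>
         (\<exists>\<epsilon> p. 0 < \<epsilon> \<and> \<epsilon> < 1 \<and> 0 < p \<and>
            (\<forall>n\<ge>1. measure P {\<omega> \<in> space P. \<xi> n \<omega> \<in> {1 - \<epsilon>..1}} \<ge> p))"
    and "\<exists>M L. 0 < M \<and> (\<forall>n\<ge>L. \<sigma> (Suc n) \<le> F (M * \<sigma> n))"
    and "x0 > 0"
    and "\<And>\<omega>. \<omega> \<in> space P \<Longrightarrow> x 0 \<omega> = x0"
    and "\<And>n \<omega>. \<omega> \<in> space P \<Longrightarrow>
           x (Suc n) \<omega> = max (f (x n \<omega>) + \<sigma> n * \<xi> (Suc n) \<omega>) 0"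
  shows "{\<omega> \<in> space P. (\<lambda>n. x n \<omega>) \<longlonglongrightarrow> 0} \<in> sets P \<and>
         measure P {\<omega> \<in> space P. (\<lambda>n. x n \<omega>) \<longlonglongrightarrow> 0} = 0"
proof -
  interpret prob_space P by fact
  note indep = assms(14) and dens = assms(16) and dens_pos = assms(17) and dens_0 = assms(18)
    and step = assms(23)
  obtain \<delta> where \<delta>: "0 < \<delta>" "\<delta> < K" "mono_on {0<..<\<delta>} f"
    using assms(9) by blast
  obtain M L where M: "0 < M" and drift: "\<And>n. n \<ge> L \<Longrightarrow> \<sigma> (Suc n) \<le> F (M * \<sigma> n)"
    using assms(20) by blast
  \<comment> \<open>Both alternatives on the noises are reduced to one uniform lower bound. In the
    identically distributed case \<epsilon> = 1/2 is chosen, and \<open>p\<close> is the common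
    probability.\<close>
  obtain \<epsilon> p where \<epsilon>: "\<epsilon> < 1" and p: "0 < p"
    and lower: "\<And>n. n \<ge> 1 \<Longrightarrow> p \<le> prob (\<xi> n -` {1 - \<epsilon>..1} \<inter> space P)"
  proof -
    consider (iid) "\<forall>m\<ge>1. \<forall>n\<ge>1. distr P borel (\<xi> m) = distr P borel (\<xi> n)"
      | (unif) "\<exists>\<epsilon> p. 0 < \<epsilon> \<and> \<epsilon> < 1 \<and> 0 < p \<and>
            (\<forall>n\<ge>1. prob {\<omega> \<in> space P. \<xi> n \<omega> \<in> {1 - \<epsilon>..1}} \<ge> p)"
      using assms(19) by blast
    then show ?thesis
    proof cases
      case iid
      define A :: "real set" where "A = {1 - 1/2..1}"
      have rv: "\<xi> n \<in> borel_measurable P" if "n \<ge> 1" for n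
        using indep that by (auto simp: indep_vars_def)
      \<comment> \<open>The open interval is used because the density is known to be positive only
        inside (-1,1), not at 1.\<close>
      have "0 < prob (\<xi> 1 -` {1/2<..<1} \<inter> space P)"
        using dens dens_pos by (intro distributed_prob_pos) auto
      also have "\<dots> \<le> prob (\<xi> 1 -` A \<inter> space P)"
        unfolding A_def using rv[of 1] by (intro finite_measure_mono measurable_sets) auto
      finally have "0 < prob (\<xi> 1 -` A \<inter> space P)" .
      moreover have "prob (\<xi> 1 -` A \<inter> space P) = prob (\<xi> n -` A \<inter> space P)" if "n \<ge> 1" for n
      proof -
        have "distr P borel (\<xi> 1) = distr P borel (\<xi> n)"
          using iid that by blast
        then have "measure (distr P borel (\<xi> 1)) A = measure (distr P borel (\<xi> n)) A"
          by (rule arg_cong)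
        then show ?thesis
          using rv that by (simp add: measure_distr A_def)
      qed
      ultimately show ?thesis
        by (intro that[of "1/2" "prob (\<xi> 1 -` A \<inter> space P)"]) (auto simp: A_def)
    next
      case unif
      then obtain \<epsilon> p where "\<epsilon> < 1" "0 < p"
        and "\<And>n. n \<ge> 1 \<Longrightarrow> p \<le> prob {\<omega> \<in> space P. \<xi> n \<omega> \<in> {1 - \<epsilon>..1}}"
        by blast
      then show ?thesis
        by (intro that[of \<epsilon> p]) (auto simp: vimage_def Int_def conj_commute)
    qed
  qed
  \<comment> \<open>The block length depends only on \<open>M\<close> and \<epsilon>, hence is the
    same for all paths.\<close>
  obtain J :: nat where J: "M / (1 - \<epsilon>) < real J"
    using reals_Archimedean2 by blast
  have "0 < M / (1 - \<epsilon>)" using M \<epsilon> by simp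
  with J have "0 < J" by linarith
  have MJ: "M \<le> real J * (1 - \<epsilon>)"
    using J \<epsilon> by (simp add: pos_divide_less_eq)
  \<comment> \<open>The starting bound \<open>N\<close> will depend on the path, so the quantifier
    over \<open>N\<close> has to stand inside the almost sure statement; countability allows
    this.\<close>
  have "AE \<omega> in P. \<forall>N. \<exists>n\<ge>N. \<forall>i\<in>{n<..n+J}. \<xi> i \<omega> \<in> {1 - \<epsilon>..1}"
    unfolding AE_all_countable using indep p lower \<open>0 < J\<close>
    by (intro allI AE_exists_long_run[where B = borel]) auto
  moreover have "AE \<omega> in P. \<forall>n. \<xi> (Suc n) \<omega> \<in> {-1..1}"
    unfolding AE_all_countable using dens dens_0
    by (intro allI distributed_AE_in[OF dens]) auto
  ultimately have "AE \<omega> in P. \<not> (\<lambda>n. x n \<omega>) \<longlonglongrightarrow> 0"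
    using AE_space
  proof eventually_elim
    case (elim \<omega>)
    have nonneg: "0 \<le> x n \<omega>" for n
      using assms(21,22) step elim by (cases n) auto
    show ?case
    proof (rule not_tendsto_0_of_long_runs[where f = f and \<sigma> = \<sigma> and e = "\<lambda>n. \<xi> n \<omega>" and L = L])
      \<comment> \<open>The strict inequality holds on (0,K) only, so \<open>y = 0\<close> is
        covered by \<open>f 0 = 0\<close>.\<close>
      show "y \<le> f y" if "0 \<le> y" "y < \<delta>" for y
        using that \<delta> assms(6) assms(8)[of y] by (cases "y = 0") auto
      show "\<sigma> (Suc n) \<le> f (M * \<sigma> n) - M * \<sigma> n" if "n \<ge> L" for n
        using drift[OF that] assms(10)[of "M * \<sigma> n"] M assms(11)[of n] by simp
      show "\<exists>n\<ge>N. \<forall>i\<in>{n<..n+J}. 1 - \<epsilon> \<le> \<xi> i \<omega>" for N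
        using elim(1) by (meson atLeastAtMost_iff)
      show "f (x n \<omega>) + \<sigma> n * \<xi> (Suc n) \<omega> \<le> x (Suc n) \<omega>" for n
        using step elim(3) by simp
      show "-1 \<le> \<xi> (Suc n) \<omega>" for n
        using elim(2) by simp
      show "0 \<le> 1 - \<epsilon>"
        using \<epsilon> by simp
    qed (fact \<delta> assms(11,12) M MJ nonneg)+
  qed
  \<comment> \<open>The almost sure statement yields a null set containing the convergence event;
    completeness of \<open>P\<close> then makes the event itself measurable.\<close>
  then obtain Z where "{\<omega> \<in> space P. (\<lambda>n. x n \<omega>) \<longlonglongrightarrow> 0} \<subseteq> Z" "Z \<in> null_sets P"
    by (auto elim!: AE_E simp: null_sets_def)
  moreover from this have "{\<omega> \<in> space P. (\<lambda>n. x n \<omega>) \<longlonglongrightarrow> 0} \<in> sets P"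
    using complete_measure.complete[OF assms(2)] by blast
  ultimately show ?thesis
    by (metis measure_eq_0_null_sets null_sets_subset)
qed

end
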